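(* Let $(M,\circ,e)$ be an $F$-manifold, $\mathcal{E}$ an eventual identity on $(M,\circ,e)$ and $\tilde{\nabla}$ a torsion-free connection on $TM$ compatible with $\circ$. The second structure connection of $(M,\circ,e,\mathcal{E},\tilde{\nabla})$, $$\nabla^{\mathcal{F}}_{X}(Y):=\mathcal{E}\circ\tilde{\nabla}_{X}(\mathcal{E}^{-1}\circ Y)-\tilde{\nabla}_{\mathcal{E}^{-1}\circ Y}(\mathcal{E})\circ X,\qquad X,Y\in\mathcal{X}(M),$$ is torsion-free and compatible on the dual $F$-manifold $(M,*,\mathcal{E})$, where $X*Y=X\circ Y\circ\mathcal{E}^{-1}$. Moreover, it belongs to the family of connections of the form $$\nabla^{A}_{X}Y=\mathcal{E}\circ\tilde{\nabla}_{X}(\mathcal{E}^{-1}\circ Y)+A(Y)\circ X\quad\text{with}\quad A(Y)=\mathcal{E}\circ\tilde{\nabla}_{Y}(\mathcal{E}^{-1})+V\circ Y,\qquad\forall X,Y\in\mathcal{X}(M),$$ where $V$ ranges over all vector fields on $M$.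
   Context: Everything is in the smooth category; $\mathcal{X}(M)$ denotes the vector fields on the manifold $M$. $F$-manifold: a triple $(M,\circ,e)$ where $M$ is a manifold and $\circ$ is a fiber-preserving commutative, associative, bilinear multiplication on $TM$ with unit field $e$, such that $L_{X\circ Y}(\circ)=X\circ L_{Y}(\circ)+Y\circ L_{X}(\circ)$ for all $X,Y\in\mathcal{X}(M)$, where $L_{Z}(\circ)(X,Y)=[Z,X\circ Y]-[Z,X]\circ Y-X\circ[Z,Y]$. Invertible vector field: $\mathcal{E}$ is invertible if there is a vector field $\mathcal{E}^{-1}$ with $\mathcal{E}\circ\mathcal{E}^{-1}=e$. Eventual identity on an $F$-manifold $(M,\circ,e)$: an invertible vector field $\mathcal{E}$ such that the multiplication $X*Y:=X\circ Y\circ\mathcal{E}^{-1}$ (whose unit field is $\mathcal{E}$) defines an $F$-manifold $(M,*,\mathcal{E})$, called the dual $F$-manifold. Compatible connection: a connection $\nabla$ on $TM$ is compatible with a commutative, associative multiplication $\circ$ on $TM$ (or compatible on the corresponding $F$-manifold) if $\nabla_{X}(\circ)(Y,Z):=\nabla_{X}(Y\circ Z)-\nabla_{X}(Y)\circ Z-Y\circ\nabla_{X}(Z)$ is totally symmetric in $X,Y,Z$ (the same definition is used with $*$ in place of $\circ$). *)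

theory Defs
  imports "HOL-Analysis.Analysis" "HOL-Library.Function_Algebras"
begin

section \<open>Smooth manifolds\<close>

text \<open>\<open>C\<^sup>k\<close> and \<open>C\<^sup>\<infinity>\<close> functions on an open subset of a finite-dimensional normed space.\<close>

primrec Ck_on :: "nat \<Rightarrow> 'e::real_normed_vector set \<Rightarrow> ('e \<Rightarrow> 'f::real_normed_vector) \<Rightarrow> bool" where
  "Ck_on 0 S f \<longleftrightarrow> continuous_on S f"
| "Ck_on (Suc k) S f \<longleftrightarrow>
     (\<forall>x\<in>S. f differentiable (at x)) \<and> (\<forall>v. Ck_on k S (\<lambda>x. frechet_derivative f (at x) v))"

definition smooth_on :: "'e::real_normed_vector set \<Rightarrow> ('e \<Rightarrow> 'f::real_normed_vector) \<Rightarrow> bool" where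
  "smooth_on S f \<longleftrightarrow> (\<forall>k. Ck_on k S f)"

text \<open>The points of the manifold are the elements of a Hausdorff, second countable type \<open>'m\<close>, and
  a chart is a pair \<open>(U, \<phi>)\<close> of an open domain and a coordinate map. The model space is an arbitrary
  finite-dimensional real normed space; class \<open>euclidean_space\<close> would exclude
  zero-dimensional manifolds.\<close>

type_synonym ('m, 'e) atlas = "('m set \<times> ('m \<Rightarrow> 'e)) set"

definition smooth_manifold ::
  "('m::{t2_space, second_countable_topology}, 'e::real_normed_vector) atlas \<Rightarrow> bool" where
  "smooth_manifold \<A> \<longleftrightarrow>
     (\<exists>B::'e set. finite B \<and> span B = UNIV) \<and>
     (\<Union>(U, \<phi>)\<in>\<A>. U) = UNIV \<and>
     (\<forall>(U, \<phi>)\<in>\<A>. open U \<and> open (\<phi> ` U) \<and> homeomorphism U (\<phi> ` U) \<phi> (inv_into U \<phi>)) \<and>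
     (\<forall>(U, \<phi>)\<in>\<A>. \<forall>(V, \<psi>)\<in>\<A>. smooth_on (\<phi> ` (U \<inter> V)) (\<psi> \<circ> inv_into U \<phi>))"

definition smooth_functions ::
  "('m::{t2_space, second_countable_topology}, 'e::real_normed_vector) atlas \<Rightarrow> ('m \<Rightarrow> real) set" where
  "smooth_functions \<A> = {f. \<forall>(U, \<phi>)\<in>\<A>. smooth_on (\<phi> ` U) (f \<circ> inv_into U \<phi>)}"


section \<open>Tangent vectors and vector fields\<close>

text \<open>Tangent vectors at \<open>p\<close> are the derivations at \<open>p\<close> of the algebra of smooth functions. The
  last condition fixes the (meaningless) values on non-smooth functions, so that tangent vectors are
  equal in HOL iff they are equal as derivations. Sums and differences of tangent vectors and
  of vector fields are the pointwise ones.\<close>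

type_synonym 'm tangent = "('m \<Rightarrow> real) \<Rightarrow> real"
type_synonym 'm field = "'m \<Rightarrow> 'm tangent"

definition tangent_space ::
  "('m::{t2_space, second_countable_topology}, 'e::real_normed_vector) atlas \<Rightarrow> 'm \<Rightarrow> 'm tangent set" where
  "tangent_space \<A> p = {v.
     (\<forall>f\<in>smooth_functions \<A>. \<forall>g\<in>smooth_functions \<A>. v (\<lambda>q. f q + g q) = v f + v g) \<and>
     (\<forall>c. \<forall>f\<in>smooth_functions \<A>. v (\<lambda>q. c * f q) = c * v f) \<and>
     (\<forall>f\<in>smooth_functions \<A>. \<forall>g\<in>smooth_functions \<A>. v (\<lambda>q. f q * g q) = f p * v g + g p * v f) \<and>
     (\<forall>f. f \<notin> smooth_functions \<A> \<longrightarrow> v f = 0)}"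

definition scale_tangent :: "real \<Rightarrow> 'm tangent \<Rightarrow> 'm tangent" where
  "scale_tangent c v = (\<lambda>f. c * v f)"

definition scale_field :: "('m \<Rightarrow> real) \<Rightarrow> 'm field \<Rightarrow> 'm field" where
  "scale_field f X = (\<lambda>p. scale_tangent (f p) (X p))"

definition field_apply :: "'m field \<Rightarrow> ('m \<Rightarrow> real) \<Rightarrow> 'm \<Rightarrow> real" where
  "field_apply X f = (\<lambda>p. X p f)"

text \<open>A section of the tangent bundle is smooth iff it maps smooth functions to smooth functions.\<close>

definition vector_fields ::
  "('m::{t2_space, second_countable_topology}, 'e::real_normed_vector) atlas \<Rightarrow> 'm field set" where
  "vector_fields \<A> = {X. (\<forall>p. X p \<in> tangent_space \<A> p) \<and>
     (\<forall>f\<in>smooth_functions \<A>. field_apply X f \<in> smooth_functions \<A>)}"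

definition lie_bracket :: "'m field \<Rightarrow> 'm field \<Rightarrow> 'm field" where
  "lie_bracket X Y = (\<lambda>p f. X p (field_apply Y f) - Y p (field_apply X f))"


section \<open>F-manifolds\<close>

type_synonym 'm multiplication = "'m \<Rightarrow> 'm tangent \<Rightarrow> 'm tangent \<Rightarrow> 'm tangent"

definition field_mult :: "'m field \<Rightarrow> 'm multiplication \<Rightarrow> 'm field \<Rightarrow> 'm field"
    ("(_ \<odot>\<^bsub>_\<^esub> _)" [71, 0, 70] 70) where
  "X \<odot>\<^bsub>m\<^esub> Y = (\<lambda>p. m p (X p) (Y p))"

text \<open>The last condition is smoothness of the multiplication. Linearity in the second
  argument follows from commutativity.\<close>

definition comm_assoc_multiplication ::
  "('m::{t2_space, second_countable_topology}, 'e::real_normed_vector) atlas \<Rightarrow> 'm multiplication \<Rightarrow> bool" where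
  "comm_assoc_multiplication \<A> m \<longleftrightarrow>
     (\<forall>p. \<forall>u\<in>tangent_space \<A> p. \<forall>v\<in>tangent_space \<A> p.
        m p u v \<in> tangent_space \<A> p \<and>
        m p u v = m p v u \<and>
        (\<forall>c. m p (scale_tangent c u) v = scale_tangent c (m p u v)) \<and>
        (\<forall>w\<in>tangent_space \<A> p.
           m p (u + v) w = m p u w + m p v w \<and>
           m p (m p u v) w = m p u (m p v w))) \<and>
     (\<forall>X\<in>vector_fields \<A>. \<forall>Y\<in>vector_fields \<A>. X \<odot>\<^bsub>m\<^esub> Y \<in> vector_fields \<A>)"

definition lie_derivative_mult ::
  "'m multiplication \<Rightarrow> 'm field \<Rightarrow> 'm field \<Rightarrow> 'm field \<Rightarrow> 'm field" where
  "lie_derivative_mult m Z X Y =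
     lie_bracket Z (X \<odot>\<^bsub>m\<^esub> Y) - (lie_bracket Z X) \<odot>\<^bsub>m\<^esub> Y - X \<odot>\<^bsub>m\<^esub> (lie_bracket Z Y)"

definition F_manifold ::
  "('m::{t2_space, second_countable_topology}, 'e::real_normed_vector) atlas
   \<Rightarrow> 'm multiplication \<Rightarrow> 'm field \<Rightarrow> bool" where
  "F_manifold \<A> m e \<longleftrightarrow>
     smooth_manifold \<A> \<and>
     comm_assoc_multiplication \<A> m \<and>
     e \<in> vector_fields \<A> \<and>
     (\<forall>p. \<forall>u\<in>tangent_space \<A> p. m p (e p) u = u) \<and>
     (\<forall>X\<in>vector_fields \<A>. \<forall>Y\<in>vector_fields \<A>. \<forall>Z\<in>vector_fields \<A>. \<forall>W\<in>vector_fields \<A>.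
        lie_derivative_mult m (X \<odot>\<^bsub>m\<^esub> Y) Z W =
          X \<odot>\<^bsub>m\<^esub> (lie_derivative_mult m Y Z W) + Y \<odot>\<^bsub>m\<^esub> (lie_derivative_mult m X Z W))"

definition invertible_field ::
  "('m::{t2_space, second_countable_topology}, 'e::real_normed_vector) atlas
   \<Rightarrow> 'm multiplication \<Rightarrow> 'm field \<Rightarrow> 'm field \<Rightarrow> bool" where
  "invertible_field \<A> m e E \<longleftrightarrow>
     E \<in> vector_fields \<A> \<and> (\<exists>F\<in>vector_fields \<A>. E \<odot>\<^bsub>m\<^esub> F = e)"

definition inverse_field ::
  "('m::{t2_space, second_countable_topology}, 'e::real_normed_vector) atlas
   \<Rightarrow> 'm multiplication \<Rightarrow> 'm field \<Rightarrow> 'm field \<Rightarrow> 'm field" where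
  "inverse_field \<A> m e E = (THE F. F \<in> vector_fields \<A> \<and> E \<odot>\<^bsub>m\<^esub> F = e)"

lemma inverse_field_eqI:
  assumes F: "F_manifold \<A> m e" and E: "E \<in> vector_fields \<A>"
    and G: "G \<in> vector_fields \<A>" "E \<odot>\<^bsub>m\<^esub> G = e"
  shows "inverse_field \<A> m e E = G"
  unfolding inverse_field_def
proof (rule the_equality)
  show "G \<in> vector_fields \<A> \<and> E \<odot>\<^bsub>m\<^esub> G = e"
    using G by blast
next
  fix H assume H: "H \<in> vector_fields \<A> \<and> E \<odot>\<^bsub>m\<^esub> H = e"
  have T: "X p \<in> tangent_space \<A> p" if "X \<in> vector_fields \<A>" for X p
    using that by (simp add: vector_fields_def)
  have comm: "m p u v = m p v u"
    and assoc: "w \<in> tangent_space \<A> p \<Longrightarrow> m p (m p u v) w = m p u (m p v w)"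
    if "u \<in> tangent_space \<A> p" "v \<in> tangent_space \<A> p" for p u v w
    using F that unfolding F_manifold_def comm_assoc_multiplication_def by blast+
  have unit: "m p (e p) u = u" if "u \<in> tangent_space \<A> p" for p u
    using F that unfolding F_manifold_def by blast
  have mult: "m p (E p) (G p) = e p" "m p (E p) (H p) = e p" for p
    using G H by (simp_all add: field_mult_def fun_eq_iff)
  show "H = G"
  proof
    fix p
    note t = T[OF E, of p] T[OF G(1), of p] T[OF conjunct1[OF H], of p]
    have "H p = m p (m p (G p) (E p)) (H p)"
      using unit[OF t(3)] mult(1)[of p] comm[OF t(1,2)] by simp
    also have "\<dots> = m p (G p) (e p)"
      using assoc[OF t(2,1,3)] mult(2)[of p] by simp
    also have "\<dots> = G p"
      using F unit[OF t(2)] comm[OF t(2) T[of e p]] by (simp add: F_manifold_def)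
    finally show "H p = G p" .
  qed
qed

definition dual_mult ::
  "('m::{t2_space, second_countable_topology}, 'e::real_normed_vector) atlas
   \<Rightarrow> 'm multiplication \<Rightarrow> 'm field \<Rightarrow> 'm field \<Rightarrow> 'm multiplication" where
  "dual_mult \<A> m e E = (\<lambda>p u v. m p (m p u v) (inverse_field \<A> m e E p))"

lemma field_mult_dual_mult:
  "X \<odot>\<^bsub>dual_mult \<A> m e E\<^esub> Y = (X \<odot>\<^bsub>m\<^esub> Y) \<odot>\<^bsub>m\<^esub> (inverse_field \<A> m e E)"
  by (simp add: field_mult_def dual_mult_def)

definition eventual_identity ::
  "('m::{t2_space, second_countable_topology}, 'e::real_normed_vector) atlas
   \<Rightarrow> 'm multiplication \<Rightarrow> 'm field \<Rightarrow> 'm field \<Rightarrow> bool" where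
  "eventual_identity \<A> m e E \<longleftrightarrow>
     invertible_field \<A> m e E \<and> F_manifold \<A> (dual_mult \<A> m e E) E"


section \<open>Connections\<close>

text \<open>A connection is only constrained on smooth vector fields; its values on other
  arguments are irrelevant.\<close>

type_synonym 'm covariant = "'m field \<Rightarrow> 'm field \<Rightarrow> 'm field"

definition connection ::
  "('m::{t2_space, second_countable_topology}, 'e::real_normed_vector) atlas \<Rightarrow> 'm covariant \<Rightarrow> bool" where
  "connection \<A> D \<longleftrightarrow>
     (\<forall>X\<in>vector_fields \<A>. \<forall>Y\<in>vector_fields \<A>.
        D X Y \<in> vector_fields \<A> \<and>
        (\<forall>Z\<in>vector_fields \<A>. D (X + Y) Z = D X Z + D Y Z \<and> D Z (X + Y) = D Z X + D Z Y) \<and>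
        (\<forall>f\<in>smooth_functions \<A>.
           D (scale_field f X) Y = scale_field f (D X Y) \<and>
           D X (scale_field f Y) = scale_field (field_apply X f) Y + scale_field f (D X Y)))"

definition torsion_free ::
  "('m::{t2_space, second_countable_topology}, 'e::real_normed_vector) atlas \<Rightarrow> 'm covariant \<Rightarrow> bool" where
  "torsion_free \<A> D \<longleftrightarrow>
     (\<forall>X\<in>vector_fields \<A>. \<forall>Y\<in>vector_fields \<A>. D X Y - D Y X - lie_bracket X Y = 0)"

definition cov_mult :: "'m multiplication \<Rightarrow> 'm covariant \<Rightarrow> 'm field \<Rightarrow> 'm field \<Rightarrow> 'm field \<Rightarrow> 'm field" where
  "cov_mult m D X Y Z = D X (Y \<odot>\<^bsub>m\<^esub> Z) - (D X Y) \<odot>\<^bsub>m\<^esub> Z - Y \<odot>\<^bsub>m\<^esub> (D X Z)"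

text \<open>Invariance under the two adjacent transpositions is invariance under all permutations.\<close>

definition compatible ::
  "('m::{t2_space, second_countable_topology}, 'e::real_normed_vector) atlas
   \<Rightarrow> 'm multiplication \<Rightarrow> 'm covariant \<Rightarrow> bool" where
  "compatible \<A> m D \<longleftrightarrow>
     (\<forall>X\<in>vector_fields \<A>. \<forall>Y\<in>vector_fields \<A>. \<forall>Z\<in>vector_fields \<A>.
        cov_mult m D X Y Z = cov_mult m D Y X Z \<and>
        cov_mult m D X Y Z = cov_mult m D X Z Y)"

definition second_structure_connection ::
  "('m::{t2_space, second_countable_topology}, 'e::real_normed_vector) atlas
   \<Rightarrow> 'm multiplication \<Rightarrow> 'm field \<Rightarrow> 'm field \<Rightarrow> 'm covariant \<Rightarrow> 'm covariant" where
  "second_structure_connection \<A> m e E D X Y =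
     (let Ei = inverse_field \<A> m e E in
      E \<odot>\<^bsub>m\<^esub> (D X (Ei \<odot>\<^bsub>m\<^esub> Y)) - (D (Ei \<odot>\<^bsub>m\<^esub> Y) E) \<odot>\<^bsub>m\<^esub> X)"

definition connection_family ::
  "('m::{t2_space, second_countable_topology}, 'e::real_normed_vector) atlas
   \<Rightarrow> 'm multiplication \<Rightarrow> 'm field \<Rightarrow> 'm field \<Rightarrow> 'm covariant \<Rightarrow> 'm covariant set" where
  "connection_family \<A> m e E D =
     (let Ei = inverse_field \<A> m e E;
          A = (\<lambda>V Y. E \<odot>\<^bsub>m\<^esub> (D Y Ei) + V \<odot>\<^bsub>m\<^esub> Y)
      in {D'. connection \<A> D' \<and>
           (\<exists>V\<in>vector_fields \<A>. \<forall>X\<in>vector_fields \<A>. \<forall>Y\<in>vector_fields \<A>.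
              D' X Y = E \<odot>\<^bsub>m\<^esub> (D X (Ei \<odot>\<^bsub>m\<^esub> Y)) + (A V Y) \<odot>\<^bsub>m\<^esub> X)})"

end

theory Submission
  imports Defs
begin

text \<open>
  Write \<open>i\<close> for \<open>\<E>\<^sup>-\<^sup>1\<close>, \<open>\<nabla>\<close> for the given connection and \<open>S\<close> for the totally symmetric tensor
  \<open>\<nabla>(\<circ>)\<close>. In any \<open>F\<close>-manifold the Lie
  derivative of the multiplication along the unit field vanishes. Applied to the dual \<open>F\<close>-manifold,
  whose unit field is \<open>\<E>\<close>, this shows that \<open>L\<^bsub>\<E>\<^esub>(\<circ>)(X, Y)\<close> depends only on \<open>X \<circ> Y\<close>, so it equals
  \<open>[e, \<E>] \<circ> X \<circ> Y\<close>; applied to \<open>e = \<E> \<circ> i\<close> it gives the analogous formula for \<open>L\<^bsub>i\<^esub>(\<circ>)\<close>. Using the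
  symmetry of \<open>S\<close>, the second structure connection becomes \<open>\<nabla>\<^bsub>X\<^esub>Y\<close> minus a function of \<open>X \<circ> Y\<close>,
  hence it is torsion-free, and it lies in the family with \<open>V = [e, \<E>] \<circ> i - \<nabla>\<^bsub>i\<^esub>\<E> - \<nabla>\<^bsub>e\<^esub>e\<close>.
  Compatibility reduces to a symmetry in \<open>X\<close> and \<open>Y\<close>, which follows from the identity
  \<open>S(U, X, Y \<circ> Z) + S(U, Y, Z) \<circ> X = S(U, X \<circ> Y, Z) + S(U, X, Y) \<circ> Z\<close> and the formula for
  \<open>L\<^bsub>i\<^esub>(\<circ>)\<close>. All of this is algebra in the commutative algebra of vector fields.
\<close>

section \<open>Commutative algebras with a compatible covariant derivative\<close>

text \<open>Abstracts the vector fields under the pointwise product. They form a subset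
  \<open>C\<close> of a larger function type, so closure is assumed. \<open>D_compatible\<close> is
  one transposition of the total symmetry; the other comes from commutativity.\<close>

locale compatible_derivation =
  fixes C :: "'a::ab_group_add set"
    and mul :: "'a \<Rightarrow> 'a \<Rightarrow> 'a" (infixl "\<star>" 70)
    and e :: 'a
    and D :: "'a \<Rightarrow> 'a \<Rightarrow> 'a"
  assumes unit_closed [simp]: "e \<in> C"
    and diff_closed [simp]: "x \<in> C \<Longrightarrow> y \<in> C \<Longrightarrow> x - y \<in> C"
    and mul_closed [simp]: "x \<in> C \<Longrightarrow> y \<in> C \<Longrightarrow> x \<star> y \<in> C"
    and D_closed [simp]: "x \<in> C \<Longrightarrow> y \<in> C \<Longrightarrow> D x y \<in> C"
    and mul_comm: "x \<in> C \<Longrightarrow> y \<in> C \<Longrightarrow> x \<star> y = y \<star> x"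
    and mul_assoc: "x \<in> C \<Longrightarrow> y \<in> C \<Longrightarrow> z \<in> C \<Longrightarrow> x \<star> y \<star> z = x \<star> (y \<star> z)"
    and mul_unit [simp]: "x \<in> C \<Longrightarrow> e \<star> x = x"
    and add_mul: "x \<in> C \<Longrightarrow> y \<in> C \<Longrightarrow> z \<in> C \<Longrightarrow> (x + y) \<star> z = x \<star> z + y \<star> z"
    and D_compatible: "x \<in> C \<Longrightarrow> y \<in> C \<Longrightarrow> z \<in> C \<Longrightarrow>
          D x (y \<star> z) - D x y \<star> z - y \<star> D x z = D y (x \<star> z) - D y x \<star> z - x \<star> D y z"
begin

lemma zero_closed [simp]: "0 \<in> C"
  using diff_closed [of e e] by simp

lemma uminus_closed [simp]: "x \<in> C \<Longrightarrow> - x \<in> C"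
  using diff_closed [of 0 x] by simp

lemma add_closed [simp]: "x \<in> C \<Longrightarrow> y \<in> C \<Longrightarrow> x + y \<in> C"
  using diff_closed [of x "- y"] by simp

lemma mul_add: "x \<in> C \<Longrightarrow> y \<in> C \<Longrightarrow> z \<in> C \<Longrightarrow> z \<star> (x + y) = z \<star> x + z \<star> y"
  by (simp add: mul_comm [of z] add_mul)

lemma diff_mul: "x \<in> C \<Longrightarrow> y \<in> C \<Longrightarrow> z \<in> C \<Longrightarrow> (x - y) \<star> z = x \<star> z - y \<star> z"
  using add_mul [of "x - y" y z] by simp

lemma mul_diff: "x \<in> C \<Longrightarrow> y \<in> C \<Longrightarrow> z \<in> C \<Longrightarrow> z \<star> (x - y) = z \<star> x - z \<star> y"
  by (simp add: mul_comm [of z] diff_mul)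

lemma minus_mul: "x \<in> C \<Longrightarrow> z \<in> C \<Longrightarrow> - x \<star> z = - (x \<star> z)"
  using diff_mul [of x x z] diff_mul [of 0 x z] by simp

lemma mul_minus: "x \<in> C \<Longrightarrow> z \<in> C \<Longrightarrow> z \<star> - x = - (z \<star> x)"
  by (simp add: mul_comm [of z] minus_mul)

lemma mul_left_comm: "x \<in> C \<Longrightarrow> y \<in> C \<Longrightarrow> z \<in> C \<Longrightarrow> y \<star> (x \<star> z) = x \<star> (y \<star> z)"
  by (metis mul_assoc mul_comm)

lemma mul_unit_right [simp]: "x \<in> C \<Longrightarrow> x \<star> e = x"
  using mul_comm [of x e] by simp

lemmas mul_ac = mul_assoc mul_comm mul_left_comm
lemmas mul_distribs = add_mul mul_add diff_mul mul_diff minus_mul mul_minus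

definition cov :: "'a \<Rightarrow> 'a \<Rightarrow> 'a \<Rightarrow> 'a" where
  "cov x y z = D x (y \<star> z) - D x y \<star> z - y \<star> D x z"

text \<open>For torsion-free \<open>D\<close> this is the Lie bracket, and \<open>lie_mul\<close> is
  then the Lie derivative of the product.\<close>

definition bracket :: "'a \<Rightarrow> 'a \<Rightarrow> 'a" where
  "bracket x y = D x y - D y x"

definition lie_mul :: "'a \<Rightarrow> 'a \<Rightarrow> 'a \<Rightarrow> 'a" where
  "lie_mul z x y = bracket z (x \<star> y) - bracket z x \<star> y - x \<star> bracket z y"

lemma cov_closed [simp]: "x \<in> C \<Longrightarrow> y \<in> C \<Longrightarrow> z \<in> C \<Longrightarrow> cov x y z \<in> C"
  by (simp add: cov_def)

lemma bracket_closed [simp]: "x \<in> C \<Longrightarrow> y \<in> C \<Longrightarrow> bracket x y \<in> C"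
  by (simp add: bracket_def)

lemma lie_mul_closed [simp]: "x \<in> C \<Longrightarrow> y \<in> C \<Longrightarrow> z \<in> C \<Longrightarrow> lie_mul z x y \<in> C"
  by (simp add: lie_mul_def)

lemma cov_swap12: "x \<in> C \<Longrightarrow> y \<in> C \<Longrightarrow> z \<in> C \<Longrightarrow> cov x y z = cov y x z"
  unfolding cov_def by (rule D_compatible)

lemma cov_swap23: "x \<in> C \<Longrightarrow> y \<in> C \<Longrightarrow> z \<in> C \<Longrightarrow> cov x y z = cov x z y"
  by (simp add: cov_def mul_comm algebra_simps)

text \<open>Up to sign, \<open>cov u\<close> is the Hochschild coboundary of \<open>D u\<close>:
  both sides expand to \<open>D u (x \<star> y \<star> z)\<close> minus the three terms in which
  \<open>D u\<close> acts on one factor.\<close>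

lemma cov_cocycle:
  assumes "u \<in> C" "x \<in> C" "y \<in> C" "z \<in> C"
  shows "cov u x (y \<star> z) + cov u y z \<star> x = cov u (x \<star> y) z + cov u x y \<star> z"
  using assms by (simp add: cov_def mul_distribs mul_ac algebra_simps)

text \<open>\<open>cov x e e\<close> collapses to \<open>- D x e\<close> and
  \<open>cov e x e\<close> to \<open>- (x \<star> D e e)\<close>; symmetry equates them.\<close>

lemma D_unit:
  assumes "x \<in> C"
  shows "D x e = D e e \<star> x"
  using cov_swap12 [of x e e] assms by (simp add: cov_def mul_comm)

text \<open>Symmetry moves \<open>z\<close> into the differentiating slot of \<open>cov\<close>; the
  remaining derivatives pair up into the brackets of \<open>lie_mul z x y\<close>. Used at
  \<open>z = E\<close>, where \<open>lie_mul_E\<close> evaluates the last term.\<close>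

lemma D_add_D_eq:
  assumes "x \<in> C" "y \<in> C" "z \<in> C"
  shows "D x z \<star> y + D y z \<star> x + cov x z y = D (x \<star> y) z + lie_mul z x y"
proof -
  have "cov x z y = D z (x \<star> y) - D z x \<star> y - x \<star> D z y"
    using assms cov_swap12 [of x z y] by (simp add: cov_def)
  then show ?thesis
    using assms by (simp add: lie_mul_def bracket_def mul_distribs mul_ac algebra_simps)
qed

end

section \<open>Eventual identities and the second structure connection, algebraically\<close>

text \<open>\<open>lie_dual_unit\<close> is the vanishing of the Lie derivative of the dual product
  along its unit \<open>E\<close>, written in the original product; \<open>lie_mul_E_i\<close> is
  the F-manifold identity at \<open>E \<star> i = e\<close>, where the Lie derivative along
  \<open>e\<close> vanishes.\<close>

locale eventual_identity_algebra = compatible_derivation +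
  fixes E i :: 'a
  assumes E_closed [simp]: "E \<in> C" and i_closed [simp]: "i \<in> C"
    and E_i: "E \<star> i = e"
    and lie_dual_unit: "x \<in> C \<Longrightarrow> y \<in> C \<Longrightarrow>
          bracket E (x \<star> y \<star> i) = bracket E x \<star> y \<star> i + x \<star> bracket E y \<star> i"
    and lie_mul_E_i: "x \<in> C \<Longrightarrow> y \<in> C \<Longrightarrow> E \<star> lie_mul i x y + i \<star> lie_mul E x y = 0"
begin

lemma E_i_cancel [simp]: "x \<in> C \<Longrightarrow> E \<star> (i \<star> x) = x"
  using mul_assoc [of E i x] by (simp add: E_i)

lemma i_E_cancel [simp]: "x \<in> C \<Longrightarrow> i \<star> (E \<star> x) = x"
  using E_i_cancel mul_left_comm by simp

lemma lie_mul_E: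
  assumes "x \<in> C" "y \<in> C"
  shows "lie_mul E x y = bracket e E \<star> (x \<star> y)"
proof -
  \<comment> \<open>The right-hand side sees \<open>x\<close> and \<open>y\<close> only through
    \<open>x \<star> y\<close>, so the pair may be replaced by \<open>e\<close> and
    \<open>x \<star> y\<close>.\<close>
  have *: "i \<star> lie_mul E x y = - (lie_mul E (x \<star> y) i + x \<star> y \<star> bracket E i)"
    if "x \<in> C" "y \<in> C" for x y
    using that lie_dual_unit [OF that] by (simp add: lie_mul_def mul_distribs mul_ac algebra_simps)
  have "i \<star> lie_mul E x y = i \<star> lie_mul E e (x \<star> y)"
    using assms by (simp add: *)
  then have "E \<star> (i \<star> lie_mul E x y) = E \<star> (i \<star> lie_mul E e (x \<star> y))"
    by (rule arg_cong)
  then have "lie_mul E x y = lie_mul E e (x \<star> y)"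
    using assms by simp
  also have "\<dots> = bracket e E \<star> (x \<star> y)"
    using assms by (simp add: lie_mul_def bracket_def mul_distribs)
  finally show ?thesis .
qed

lemma lie_mul_i:
  assumes "x \<in> C" "y \<in> C"
  shows "lie_mul i x y = - (i \<star> (i \<star> (bracket e E \<star> (x \<star> y))))"
proof -
  have "E \<star> lie_mul i x y = - (i \<star> lie_mul E x y)"
    using lie_mul_E_i [OF assms] by (simp add: eq_neg_iff_add_eq_0)
  then have "i \<star> (E \<star> lie_mul i x y) = - (i \<star> (i \<star> lie_mul E x y))"
    using assms by (simp add: mul_minus)
  then show ?thesis
    using assms by (simp add: lie_mul_E)
qed

definition second :: "'a \<Rightarrow> 'a \<Rightarrow> 'a" where
  "second x y = E \<star> D x (i \<star> y) - D (i \<star> y) E \<star> x"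

lemma second_closed: "x \<in> C \<Longrightarrow> y \<in> C \<Longrightarrow> second x y \<in> C"
  by (simp add: second_def)

text \<open>Pulling \<open>E\<close> through \<open>D x\<close> costs
  \<open>cov x E (i \<star> y)\<close>; \<open>D_add_D_eq\<close> and \<open>lie_mul_E\<close>
  gather this with the other terms into an expression in \<open>x \<star> y\<close> alone, which
  cancels in the torsion.\<close>

lemma second_eq:
  assumes "x \<in> C" "y \<in> C"
  shows "second x y = D x y - (D (i \<star> (x \<star> y)) E + bracket e E \<star> (i \<star> (x \<star> y)))"
proof -
  have 1: "E \<star> D x (i \<star> y) = D x y - D x E \<star> (i \<star> y) - cov x E (i \<star> y)"
    using assms by (simp add: cov_def)
  have 2: "D (i \<star> (x \<star> y)) E + bracket e E \<star> (i \<star> (x \<star> y)) =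
      D x E \<star> (i \<star> y) + D (i \<star> y) E \<star> x + cov x E (i \<star> y)"
    using assms D_add_D_eq [of x "i \<star> y" E] by (simp add: lie_mul_E mul_left_comm [of i x])
  show ?thesis
    unfolding second_def 1 2 by simp
qed

lemma second_torsion_free:
  assumes "x \<in> C" "y \<in> C"
  shows "second x y - second y x = bracket x y"
  using assms mul_comm [of y x] by (simp add: second_eq bracket_def)

text \<open>The witness for the family of connections: the coefficient of \<open>y\<close> left over
  when \<open>- D (i \<star> y) E\<close> is expanded and \<open>E \<star> D y i\<close> is split
  off.\<close>

definition V :: 'a where
  "V = bracket e E \<star> i - D i E - D e e"

lemma V_closed [simp]: "V \<in> C"
  by (simp add: V_def)

lemma second_V:
  assumes "x \<in> C" "y \<in> C"
  shows "second x y = E \<star> D x (i \<star> y) + (E \<star> D y i + V \<star> y) \<star> x"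
proof -
  have "D y E \<star> i + D i E \<star> y + cov y E i = D (i \<star> y) E + bracket e E \<star> (i \<star> y)"
    using assms D_add_D_eq [of y i E] by (simp add: lie_mul_E mul_comm [of y i])
  \<comment> \<open>Since \<open>E \<star> i = e\<close>, the leading term of \<open>cov\<close> is
    \<open>D y e\<close>, which \<open>D_unit\<close> evaluates.\<close>
  moreover have "cov y E i = D e e \<star> y - D y E \<star> i - E \<star> D y i"
    using assms D_unit [of y] by (simp add: cov_def E_i)
  ultimately have "- D (i \<star> y) E = E \<star> D y i + V \<star> y"
    using assms by (simp add: V_def mul_distribs mul_ac algebra_simps)
  then have "- D (i \<star> y) E \<star> x = (E \<star> D y i + V \<star> y) \<star> x"
    by simp
  then show ?thesis
    using assms by (simp add: second_def minus_mul)
qed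

definition dual_cov :: "'a \<Rightarrow> 'a \<Rightarrow> 'a \<Rightarrow> 'a" where
  "dual_cov x y z = second x (y \<star> z \<star> i) - second x y \<star> z \<star> i - y \<star> second x z \<star> i"

lemma dual_cov_swap23:
  assumes "x \<in> C" "y \<in> C" "z \<in> C"
  shows "dual_cov x y z = dual_cov x z y"
  using assms second_closed by (simp add: dual_cov_def mul_ac algebra_simps)

text \<open>After expansion by \<open>second_V\<close>, the three derivatives along \<open>x\<close>
  form one \<open>cov\<close>, and the \<open>V\<close> terms add up to a single negative one. That
  term and the one with \<open>D z i\<close> are already symmetric in \<open>x\<close> and
  \<open>y\<close>; the other three are left to \<open>dual_cov_aux\<close>.\<close>

lemma dual_cov_eq:
  assumes "x \<in> C" "y \<in> C" "z \<in> C"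
  shows "dual_cov x y z = E \<star> (cov x (i \<star> y) (i \<star> z) + x \<star> D (i \<star> (y \<star> z)) i
    - i \<star> (x \<star> z \<star> D y i) - i \<star> (x \<star> y \<star> D z i)) - V \<star> (i \<star> (x \<star> (y \<star> z)))"
  using assms by (simp add: dual_cov_def cov_def second_V mul_distribs mul_ac algebra_simps)

text \<open>The cocycle identity moves the asymmetry of \<open>cov x (i \<star> y) (i \<star> z)\<close> into brackets with \<open>i\<close>.\<close>

lemma dual_cov_aux:
  assumes "x \<in> C" "y \<in> C" "z \<in> C"
  shows "cov x (i \<star> y) (i \<star> z) + x \<star> D (i \<star> (y \<star> z)) i - i \<star> (x \<star> z \<star> D y i) =
    cov (i \<star> z) (x \<star> y) i + cov (i \<star> z) x y \<star> i + x \<star> y \<star> D i (i \<star> z) - x \<star> y \<star> bracket i (i \<star> z)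
    + i \<star> (i \<star> (i \<star> (bracket e E \<star> (x \<star> (y \<star> z)))))"
proof -
  have 1: "cov x (i \<star> y) (i \<star> z) = cov (i \<star> z) x (y \<star> i)"
    using assms cov_swap12 [of x "i \<star> z" "i \<star> y"] cov_swap23 [of x "i \<star> y" "i \<star> z"]
    by (simp add: mul_comm)
  have 2: "cov (i \<star> z) x (y \<star> i) = cov (i \<star> z) (x \<star> y) i + cov (i \<star> z) x y \<star> i - cov (i \<star> z) y i \<star> x"
    using assms cov_cocycle [of "i \<star> z" x y i] by (simp add: algebra_simps)
  have 3: "cov (i \<star> z) y i = D i (i \<star> (y \<star> z)) - D i y \<star> (i \<star> z) - y \<star> D i (i \<star> z)"
  proof -
    have "cov (i \<star> z) y i = cov i y (i \<star> z)"
      using assms cov_swap12 [of i "i \<star> z" y] cov_swap23 [of "i \<star> z" y i] cov_swap23 [of i "i \<star> z" y] by simp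
    then show ?thesis
      using assms by (simp add: cov_def mul_left_comm)
  qed
  \<comment> \<open>\<open>lie_mul_i\<close> at \<open>y\<close> and \<open>i \<star> z\<close>
    exchanges direction and argument, so that \<open>D i (i \<star> (y \<star> z))\<close> cancels
    against the one in fact 3.\<close>
  have 4: "D (i \<star> (y \<star> z)) i - D i (i \<star> (y \<star> z)) =
      i \<star> (i \<star> (bracket e E \<star> (i \<star> (y \<star> z)))) - bracket i y \<star> (i \<star> z) - y \<star> bracket i (i \<star> z)"
    using assms lie_mul_i [of y "i \<star> z"]
    by (simp add: lie_mul_def mul_left_comm [of i y] bracket_def [of i "i \<star> (y \<star> z)"] algebra_simps)
  have 5: "D (i \<star> (y \<star> z)) i = D i (i \<star> (y \<star> z)) +
      (i \<star> (i \<star> (bracket e E \<star> (i \<star> (y \<star> z)))) - bracket i y \<star> (i \<star> z) - y \<star> bracket i (i \<star> z))"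
    unfolding 4 [symmetric] by simp
  show ?thesis
    unfolding 1 2 3 5 using assms
    by (simp add: bracket_def [of i y] mul_distribs mul_ac algebra_simps)
qed

text \<open>In the form of \<open>dual_cov_aux\<close>, \<open>x\<close> and \<open>y\<close> enter
  only through their product and through \<open>cov (i \<star> z) x y\<close>, which is symmetric in
  them.\<close>

lemma dual_cov_swap12:
  assumes "x \<in> C" "y \<in> C" "z \<in> C"
  shows "dual_cov x y z = dual_cov y x z"
  using assms mul_comm [of y x] mul_left_comm [of x y] cov_swap23 [of "i \<star> z" x y]
  by (simp add: dual_cov_eq dual_cov_aux)

end

section \<open>Calculus of C^k functions on open sets\<close>

text \<open>On an open set the derivative at a point depends only on nearby values, so agreement on
  \<open>S\<close> passes to the derivatives there.\<close>

lemma Ck_on_cong: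
  assumes "open S" "\<And>x. x \<in> S \<Longrightarrow> f x = g x"
  shows "Ck_on k S f \<Longrightarrow> Ck_on k S g"
  using assms(2)
proof (induction k arbitrary: f g)
  case 0
  then show ?case
    using continuous_on_cong by fastforce
next
  case (Suc k)
  have "g differentiable (at x)" "frechet_derivative f (at x) = frechet_derivative g (at x)"
    if "x \<in> S" for x
  proof -
    have f: "f differentiable (at x)"
      using Suc.prems(1) that by simp
    then show "g differentiable (at x)"
      unfolding differentiable_def
      using has_derivative_transform_within_open [OF _ assms(1) that] Suc.prems(2) by blast
    show "frechet_derivative f (at x) = frechet_derivative g (at x)"
      using frechet_derivative_transform_within_open [OF f assms(1) that] Suc.prems(2) by blast
  qed
  then show ?case
    using Suc.prems(1) Suc.IH [of "\<lambda>x. frechet_derivative f (at x) _" "\<lambda>x. frechet_derivative g (at x) _"]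
    by simp
qed

lemma Ck_on_Suc_imp: "Ck_on (Suc k) S f \<Longrightarrow> Ck_on k S f"
proof (induction k arbitrary: f)
  case 0
  then show ?case
    by (auto intro!: continuous_at_imp_continuous_on differentiable_imp_continuous_within)
next
  case (Suc k)
  then show ?case
    using Ck_on.simps(2) by blast
qed

text \<open>If the derivative of \<open>f\<close> is given by \<open>f'\<close> on the open set \<open>S\<close> only, then its Frechet derivative
  off \<open>S\<close> is arbitrary; hence the appeal to \<open>Ck_on_cong\<close>.\<close>

lemma Ck_on_SucI:
  assumes "open S"
    and f': "\<And>x. x \<in> S \<Longrightarrow> (f has_derivative f' x) (at x)"
    and "\<And>v. Ck_on k S (\<lambda>x. f' x v)"
  shows "Ck_on (Suc k) S f"
proof -
  have "Ck_on k S (\<lambda>x. frechet_derivative f (at x) v)" for v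
    using assms(1) _ assms(3) [of v]
    by (rule Ck_on_cong) (simp add: frechet_derivative_at [OF f', symmetric])
  then show ?thesis
    using f' by (auto simp: differentiable_def)
qed

lemma Ck_on_Suc_has_derivative:
  "Ck_on (Suc k) S f \<Longrightarrow> x \<in> S \<Longrightarrow> (f has_derivative frechet_derivative f (at x)) (at x)"
  by (simp add: frechet_derivative_works [symmetric])

lemma Ck_on_add:
  assumes "open S"
  shows "Ck_on k S f \<Longrightarrow> Ck_on k S g \<Longrightarrow> Ck_on k S (\<lambda>x. f x + g x)"
proof (induction k arbitrary: f g)
  case 0
  then show ?case
    by (simp add: continuous_on_add)
next
  case (Suc k)
  show ?case
  proof (rule Ck_on_SucI [OF assms])
    show "((\<lambda>x. f x + g x) has_derivative
        (\<lambda>v. frechet_derivative f (at x) v + frechet_derivative g (at x) v)) (at x)" if "x \<in> S" for x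
      using Suc.prems that by (intro has_derivative_add Ck_on_Suc_has_derivative)
    show "Ck_on k S (\<lambda>x. frechet_derivative f (at x) v + frechet_derivative g (at x) v)" for v
      using Suc by simp
  qed
qed

lemma Ck_on_minus:
  assumes "open S"
  shows "Ck_on k S f \<Longrightarrow> Ck_on k S (\<lambda>x. - f x)"
proof (induction k arbitrary: f)
  case 0
  then show ?case
    by (simp add: continuous_on_minus)
next
  case (Suc k)
  show ?case
  proof (rule Ck_on_SucI [OF assms])
    show "((\<lambda>x. - f x) has_derivative (\<lambda>v. - frechet_derivative f (at x) v)) (at x)"
      if "x \<in> S" for x
      using Suc.prems that by (intro has_derivative_minus Ck_on_Suc_has_derivative)
    show "Ck_on k S (\<lambda>x. - frechet_derivative f (at x) v)" for v
      using Suc by simp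
  qed
qed

lemma Ck_on_mult:
  fixes f g :: "'e::real_normed_vector \<Rightarrow> real"
  assumes "open S"
  shows "Ck_on k S f \<Longrightarrow> Ck_on k S g \<Longrightarrow> Ck_on k S (\<lambda>x. f x * g x)"
proof (induction k arbitrary: f g)
  case 0
  then show ?case
    by (simp add: continuous_on_mult)
next
  case (Suc k)
  show ?case
  proof (rule Ck_on_SucI [OF assms])
    show "((\<lambda>x. f x * g x) has_derivative
        (\<lambda>v. f x * frechet_derivative g (at x) v + frechet_derivative f (at x) v * g x)) (at x)"
      if "x \<in> S" for x
      using Suc.prems that by (intro has_derivative_mult Ck_on_Suc_has_derivative)
    show "Ck_on k S (\<lambda>x. f x * frechet_derivative g (at x) v + frechet_derivative f (at x) v * g x)"
      for v
      \<comment> \<open>Each product pairs a function of order \<open>Suc k\<close> with a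
        derivative of order \<open>k\<close>; the former is lowered to order \<open>k\<close> for
        the induction hypothesis.\<close>
      using Suc.prems by (intro Ck_on_add [OF assms] Suc.IH Ck_on_Suc_imp [of k S f]
          Ck_on_Suc_imp [of k S g]) simp_all
  qed
qed

section \<open>Smooth functions and vector fields on the manifold\<close>

lemma smooth_functions_diff:
  assumes "smooth_manifold \<A>" "f \<in> smooth_functions \<A>" "g \<in> smooth_functions \<A>"
  shows "(\<lambda>p. f p - g p) \<in> smooth_functions \<A>"
proof -
  have "smooth_on (\<phi> ` U) ((\<lambda>p. f p - g p) \<circ> inv_into U \<phi>)" if "(U, \<phi>) \<in> \<A>" for U \<phi>
  proof -
    have "open (\<phi> ` U)"
      using assms(1) that by (auto simp: smooth_manifold_def)
    moreover have "Ck_on k (\<phi> ` U) (f \<circ> inv_into U \<phi>)" "Ck_on k (\<phi> ` U) (g \<circ> inv_into U \<phi>)" for k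
      using assms(2,3) that by (auto simp: smooth_functions_def smooth_on_def)
    ultimately show ?thesis
      using Ck_on_add [OF _ _ Ck_on_minus] by (fastforce simp: smooth_on_def o_def)
  qed
  then show ?thesis
    by (auto simp: smooth_functions_def)
qed

lemma smooth_functions_mult:
  assumes "smooth_manifold \<A>" "f \<in> smooth_functions \<A>" "g \<in> smooth_functions \<A>"
  shows "(\<lambda>p. f p * g p) \<in> smooth_functions \<A>"
proof -
  have "smooth_on (\<phi> ` U) ((\<lambda>p. f p * g p) \<circ> inv_into U \<phi>)" if "(U, \<phi>) \<in> \<A>" for U \<phi>
  proof -
    have "open (\<phi> ` U)"
      using assms(1) that by (auto simp: smooth_manifold_def)
    moreover have "Ck_on k (\<phi> ` U) (f \<circ> inv_into U \<phi>)" "Ck_on k (\<phi> ` U) (g \<circ> inv_into U \<phi>)" for k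
      using assms(2,3) that by (auto simp: smooth_functions_def smooth_on_def)
    ultimately show ?thesis
      using Ck_on_mult by (fastforce simp: smooth_on_def o_def)
  qed
  then show ?thesis
    by (auto simp: smooth_functions_def)
qed

lemma vector_fields_tangent: "X \<in> vector_fields \<A> \<Longrightarrow> X p \<in> tangent_space \<A> p"
  by (simp add: vector_fields_def)

lemma tangent_space_diff:
  "u \<in> tangent_space \<A> p \<Longrightarrow> v \<in> tangent_space \<A> p \<Longrightarrow> u - v \<in> tangent_space \<A> p"
  by (auto simp: tangent_space_def algebra_simps)

lemma tangent_space_scale: "u \<in> tangent_space \<A> p \<Longrightarrow> scale_tangent c u \<in> tangent_space \<A> p"
  by (auto simp: tangent_space_def scale_tangent_def algebra_simps)

lemma vector_fields_diff:
  assumes "smooth_manifold \<A>" "X \<in> vector_fields \<A>" "Y \<in> vector_fields \<A>"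
  shows "X - Y \<in> vector_fields \<A>"
proof -
  have "field_apply (X - Y) f = (\<lambda>p. field_apply X f p - field_apply Y f p)" for f
    by (simp add: field_apply_def)
  then show ?thesis
    using assms by (auto simp: vector_fields_def tangent_space_diff smooth_functions_diff)
qed

lemma vector_fields_scale:
  assumes "smooth_manifold \<A>" "f \<in> smooth_functions \<A>" "X \<in> vector_fields \<A>"
  shows "scale_field f X \<in> vector_fields \<A>"
proof -
  have "field_apply (scale_field f X) g = (\<lambda>p. f p * field_apply X g p)" for g
    by (simp add: field_apply_def scale_field_def scale_tangent_def)
  then show ?thesis
    using assms
    by (auto simp: vector_fields_def scale_field_def tangent_space_scale smooth_functions_mult)
qed

lemma scale_field_diff: "scale_field f (X - Y) = scale_field f X - scale_field f Y"
  by (simp add: scale_field_def scale_tangent_def fun_eq_iff algebra_simps)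

section \<open>Products of vector fields and the Lie derivative along the unit\<close>

lemma comm_assoc_multiplication_fields:
  assumes "comm_assoc_multiplication \<A> m" "X \<in> vector_fields \<A>" "Y \<in> vector_fields \<A>"
  shows "X \<odot>\<^bsub>m\<^esub> Y \<in> vector_fields \<A>"
    and "X \<odot>\<^bsub>m\<^esub> Y = Y \<odot>\<^bsub>m\<^esub> X"
    and "scale_field f X \<odot>\<^bsub>m\<^esub> Y = scale_field f (X \<odot>\<^bsub>m\<^esub> Y)"
    and "Z \<in> vector_fields \<A> \<Longrightarrow> (X \<odot>\<^bsub>m\<^esub> Y) \<odot>\<^bsub>m\<^esub> Z = X \<odot>\<^bsub>m\<^esub> (Y \<odot>\<^bsub>m\<^esub> Z)"
    and "Z \<in> vector_fields \<A> \<Longrightarrow> (X + Y) \<odot>\<^bsub>m\<^esub> Z = X \<odot>\<^bsub>m\<^esub> Z + Y \<odot>\<^bsub>m\<^esub> Z"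
proof -
  note * = assms(1) [unfolded comm_assoc_multiplication_def]
  note T = vector_fields_tangent [OF assms(2)] vector_fields_tangent [OF assms(3)]
  show "X \<odot>\<^bsub>m\<^esub> Y \<in> vector_fields \<A>"
    using * assms(2,3) by blast
  show "X \<odot>\<^bsub>m\<^esub> Y = Y \<odot>\<^bsub>m\<^esub> X" "scale_field f X \<odot>\<^bsub>m\<^esub> Y = scale_field f (X \<odot>\<^bsub>m\<^esub> Y)"
    using * T by (simp_all add: field_mult_def scale_field_def)
  assume "Z \<in> vector_fields \<A>"
  then have "Z p \<in> tangent_space \<A> p" for p
    by (rule vector_fields_tangent)
  then show "(X \<odot>\<^bsub>m\<^esub> Y) \<odot>\<^bsub>m\<^esub> Z = X \<odot>\<^bsub>m\<^esub> (Y \<odot>\<^bsub>m\<^esub> Z)"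
    "(X + Y) \<odot>\<^bsub>m\<^esub> Z = X \<odot>\<^bsub>m\<^esub> Z + Y \<odot>\<^bsub>m\<^esub> Z"
    using * T unfolding field_mult_def fun_eq_iff plus_fun_apply by metis+
qed

lemma F_manifold_unit_mult:
  "F_manifold \<A> m e \<Longrightarrow> X \<in> vector_fields \<A> \<Longrightarrow> e \<odot>\<^bsub>m\<^esub> X = X"
  by (simp add: F_manifold_def field_mult_def vector_fields_tangent)

text \<open>With both factors equal to \<open>e\<close>, the F-manifold identity says that the
  derivative equals twice itself. Closure under brackets makes it a vector field, on which
  \<open>e\<close> acts as the unit.\<close>

lemma lie_derivative_unit:
  assumes F: "F_manifold \<A> m e"
    and bracket: "\<And>X Y. X \<in> vector_fields \<A> \<Longrightarrow> Y \<in> vector_fields \<A> \<Longrightarrow> lie_bracket X Y \<in> vector_fields \<A>"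
    and "Z \<in> vector_fields \<A>" "W \<in> vector_fields \<A>"
  shows "lie_derivative_mult m e Z W = 0"
proof -
  let ?L = "lie_derivative_mult m e Z W"
  have e: "e \<in> vector_fields \<A>" and m: "comm_assoc_multiplication \<A> m" and M: "smooth_manifold \<A>"
    using F by (simp_all add: F_manifold_def)
  have "?L \<in> vector_fields \<A>"
    using assms(3,4) e unfolding lie_derivative_mult_def
    by (intro vector_fields_diff [OF M] comm_assoc_multiplication_fields(1) [OF m] bracket)
  then have "e \<odot>\<^bsub>m\<^esub> ?L = ?L"
    by (rule F_manifold_unit_mult [OF F])
  moreover have "lie_derivative_mult m (e \<odot>\<^bsub>m\<^esub> e) Z W = e \<odot>\<^bsub>m\<^esub> ?L + e \<odot>\<^bsub>m\<^esub> ?L"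
    using F assms(3,4) e unfolding F_manifold_def by blast
  ultimately show ?thesis
    by (simp add: F_manifold_unit_mult [OF F e])
qed

section \<open>Transfer of the algebra to vector fields\<close>

lemma torsion_free_lie_bracket:
  "torsion_free \<A> D \<Longrightarrow> X \<in> vector_fields \<A> \<Longrightarrow> Y \<in> vector_fields \<A> \<Longrightarrow>
    lie_bracket X Y = D X Y - D Y X"
  by (simp add: torsion_free_def)

theorem proposition13:
  fixes \<A> :: "('m::{t2_space, second_countable_topology}, 'e::real_normed_vector) atlas"
    and m :: "'m multiplication"
    and e E :: "'m field"
    and D :: "'m covariant"
  assumes "F_manifold \<A> m e"
    and "eventual_identity \<A> m e E"
    and "connection \<A> D"
    and "torsion_free \<A> D"
    and "compatible \<A> m D"
  shows "connection \<A> (second_structure_connection \<A> m e E D) \<and>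
         torsion_free \<A> (second_structure_connection \<A> m e E D) \<and>
         compatible \<A> (dual_mult \<A> m e E) (second_structure_connection \<A> m e E D) \<and>
         second_structure_connection \<A> m e E D \<in> connection_family \<A> m e E D"
proof -
  let ?C = "vector_fields \<A>"
  let ?i = "inverse_field \<A> m e E"
  let ?N = "second_structure_connection \<A> m e E D"
  have M: "smooth_manifold \<A>" and m: "comm_assoc_multiplication \<A> m" and e: "e \<in> ?C"
    using assms(1) by (simp_all add: F_manifold_def)
  have dual: "F_manifold \<A> (dual_mult \<A> m e E) E"
    using assms(2) by (simp add: eventual_identity_def)
  obtain G where E: "E \<in> ?C" and G: "G \<in> ?C" "E \<odot>\<^bsub>m\<^esub> G = e"
    using assms(2) by (auto simp: eventual_identity_def invertible_field_def)
  \<comment> \<open>\<open>inverse_field\<close> is a definite description; uniqueness of inverses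
    identifies it with the witness \<open>G\<close>.\<close>
  have i: "?i \<in> ?C" and Ei: "E \<odot>\<^bsub>m\<^esub> ?i = e"
    using inverse_field_eqI [OF assms(1) E G] G by simp_all
  have D: "D X Y \<in> ?C" "D (X + Y) Z = D X Z + D Y Z" "D Z (X + Y) = D Z X + D Z Y"
    "f \<in> smooth_functions \<A> \<Longrightarrow> D (scale_field f X) Y = scale_field f (D X Y)"
    "f \<in> smooth_functions \<A> \<Longrightarrow>
      D X (scale_field f Y) = scale_field (field_apply X f) Y + scale_field f (D X Y)"
    if "X \<in> ?C" "Y \<in> ?C" "Z \<in> ?C" for X Y Z f
    using assms(3) that unfolding connection_def by blast+
  note bracket = torsion_free_lie_bracket [OF assms(4)]
  \<comment> \<open>Torsion-freeness makes the bracket a difference of covariant derivatives, which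
    are vector fields.\<close>
  have bracket_closed: "lie_bracket X Y \<in> ?C" if "X \<in> ?C" "Y \<in> ?C" for X Y
    using that by (simp add: bracket vector_fields_diff [OF M] D(1) [OF _ _ e])
  interpret A: compatible_derivation ?C "\<lambda>X Y. X \<odot>\<^bsub>m\<^esub> Y" e D
  proof
    show "e \<in> ?C"
      by (rule e)
    fix X Y assume X: "X \<in> ?C" and Y: "Y \<in> ?C"
    show "X - Y \<in> ?C" "D X Y \<in> ?C"
      using X Y by (simp_all add: vector_fields_diff [OF M] D(1) [OF _ _ e])
    show "X \<odot>\<^bsub>m\<^esub> Y \<in> ?C" "X \<odot>\<^bsub>m\<^esub> Y = Y \<odot>\<^bsub>m\<^esub> X"
      using X Y by (rule comm_assoc_multiplication_fields [OF m])+
    show "e \<odot>\<^bsub>m\<^esub> X = X"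
      using X by (rule F_manifold_unit_mult [OF assms(1)])
    fix Z assume Z: "Z \<in> ?C"
    show "(X \<odot>\<^bsub>m\<^esub> Y) \<odot>\<^bsub>m\<^esub> Z = X \<odot>\<^bsub>m\<^esub> (Y \<odot>\<^bsub>m\<^esub> Z)"
      "(X + Y) \<odot>\<^bsub>m\<^esub> Z = X \<odot>\<^bsub>m\<^esub> Z + Y \<odot>\<^bsub>m\<^esub> Z"
      using X Y Z by (rule comm_assoc_multiplication_fields [OF m])+
    show "D X (Y \<odot>\<^bsub>m\<^esub> Z) - (D X Y) \<odot>\<^bsub>m\<^esub> Z - Y \<odot>\<^bsub>m\<^esub> (D X Z) =
        D Y (X \<odot>\<^bsub>m\<^esub> Z) - (D Y X) \<odot>\<^bsub>m\<^esub> Z - X \<odot>\<^bsub>m\<^esub> (D Y Z)"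
      using assms(5) X Y Z unfolding compatible_def cov_mult_def by blast
  qed
  have lie_bracket: "lie_bracket X Y = A.bracket X Y" if "X \<in> ?C" "Y \<in> ?C" for X Y
    using that by (simp add: bracket A.bracket_def)
  have lie_mul: "lie_derivative_mult m Z X Y = A.lie_mul Z X Y" if "X \<in> ?C" "Y \<in> ?C" "Z \<in> ?C" for X Y Z
    using that by (simp add: lie_derivative_mult_def A.lie_mul_def lie_bracket)
  interpret A: eventual_identity_algebra ?C "\<lambda>X Y. X \<odot>\<^bsub>m\<^esub> Y" e D E ?i
  proof
    show "E \<in> ?C" "?i \<in> ?C" "E \<odot>\<^bsub>m\<^esub> ?i = e"
      by (fact E i Ei)+
    fix X Y assume X: "X \<in> ?C" and Y: "Y \<in> ?C"
    \<comment> \<open>\<open>E\<close> is the unit field of the dual F-manifold, so the lemma on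
      units applies there.\<close>
    have "lie_derivative_mult (dual_mult \<A> m e E) E X Y = 0"
      using dual bracket_closed X Y by (rule lie_derivative_unit)
    then show "A.bracket E ((X \<odot>\<^bsub>m\<^esub> Y) \<odot>\<^bsub>m\<^esub> ?i) =
        (A.bracket E X \<odot>\<^bsub>m\<^esub> Y) \<odot>\<^bsub>m\<^esub> ?i + (X \<odot>\<^bsub>m\<^esub> A.bracket E Y) \<odot>\<^bsub>m\<^esub> ?i"
      using X Y E i by (simp add: lie_derivative_mult_def field_mult_dual_mult lie_bracket algebra_simps)
    have "lie_derivative_mult m (E \<odot>\<^bsub>m\<^esub> ?i) X Y =
        E \<odot>\<^bsub>m\<^esub> lie_derivative_mult m ?i X Y + ?i \<odot>\<^bsub>m\<^esub> lie_derivative_mult m E X Y"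
      using assms(1) E i X Y unfolding F_manifold_def by blast
    moreover have "lie_derivative_mult m e X Y = 0"
      using assms(1) bracket_closed X Y by (rule lie_derivative_unit)
    ultimately show "E \<odot>\<^bsub>m\<^esub> A.lie_mul ?i X Y + ?i \<odot>\<^bsub>m\<^esub> A.lie_mul E X Y = 0"
      using X Y E i by (simp add: lie_mul Ei)
  qed
  have N: "?N X Y = A.second X Y" for X Y
    by (simp add: second_structure_connection_def A.second_def Let_def)
  have scale: "scale_field f X \<odot>\<^bsub>m\<^esub> Y = scale_field f (X \<odot>\<^bsub>m\<^esub> Y)"
    "X \<odot>\<^bsub>m\<^esub> scale_field f Y = scale_field f (X \<odot>\<^bsub>m\<^esub> Y)" "scale_field f X \<in> ?C"
    if "f \<in> smooth_functions \<A>" "X \<in> ?C" "Y \<in> ?C" for f X Y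
  proof -
    show closed: "scale_field f X \<in> ?C"
      using that by (simp add: vector_fields_scale [OF M])
    show mult: "scale_field f X \<odot>\<^bsub>m\<^esub> Y = scale_field f (X \<odot>\<^bsub>m\<^esub> Y)"
      using that by (simp add: comm_assoc_multiplication_fields(3) [OF m])
    show "X \<odot>\<^bsub>m\<^esub> scale_field f Y = scale_field f (X \<odot>\<^bsub>m\<^esub> Y)"
      using that comm_assoc_multiplication_fields(3) [OF m that(3,2)]
      by (simp add: A.mul_comm [of X] vector_fields_scale [OF M])
  qed
  have connection: "connection \<A> ?N"
    unfolding connection_def N
  proof (intro ballI conjI)
    fix X Y assume X: "X \<in> ?C" and Y: "Y \<in> ?C"
    show "A.second X Y \<in> ?C"
      using X Y by (rule A.second_closed)
    show "A.second (X + Y) Z = A.second X Z + A.second Y Z"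
      "A.second Z (X + Y) = A.second Z X + A.second Z Y" if "Z \<in> ?C" for Z
      using X Y that by (simp_all add: A.second_def D A.mul_distribs)
    fix f assume f: "f \<in> smooth_functions \<A>"
    have Xf: "field_apply X f \<in> smooth_functions \<A>"
      using X f by (simp add: vector_fields_def)
    show "A.second (scale_field f X) Y = scale_field f (A.second X Y)"
      using X Y f by (simp add: A.second_def D(4) [OF _ _ e] scale scale_field_diff)
    \<comment> \<open>The Leibniz term survives unchanged because \<open>E\<close> cancels the
      inverse field in front of \<open>Y\<close>; the second summand of \<open>A.second\<close> only
      scales by \<open>f\<close>.\<close>
    show "A.second X (scale_field f Y) = scale_field (field_apply X f) Y + scale_field f (A.second X Y)"
      using X Y f Xf
      by (simp add: A.second_def D(4) [OF _ _ e] D(5) [OF _ _ e] scale A.mul_distribs scale_field_diff)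
  qed
  moreover have "torsion_free \<A> ?N"
    by (simp add: torsion_free_def N A.second_torsion_free lie_bracket)
  moreover have "compatible \<A> (dual_mult \<A> m e E) ?N"
  proof -
    have "cov_mult (dual_mult \<A> m e E) ?N = A.dual_cov"
      by (simp add: cov_mult_def A.dual_cov_def N field_mult_dual_mult fun_eq_iff)
    then show ?thesis
      using A.dual_cov_swap12 A.dual_cov_swap23 by (simp add: compatible_def)
  qed
  moreover have "?N \<in> connection_family \<A> m e E D"
    using connection A.V_closed A.second_V by (auto simp: connection_family_def Let_def N)
  ultimately show ?thesis
    by blast
qed

end
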